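(* Let $n\ge 4$ and $0\le k\le n-2$ be integers, and let $G$ be a connected $k$-cyclic graph with $n$ vertices. Then $$\sigma(G)\le (n-1)(n-2)^2-2k(2n-5)+k^2(k-1),$$ with equality if and only if $G=H_{n,k}$.
   Context: All graphs are finite and simple. For a graph $G$ with edge set $E(G)$ and $d_w$ denoting the degree of a vertex $w$, the sigma index is $\sigma(G)=\sum_{uv\in E(G)}(d_u-d_v)^2$. A connected $k$-cyclic graph is a connected graph of order $n$ and size $n+k-1$. The star $S_n$ is the graph on $n$ vertices with one vertex (the center) adjacent to all other $n-1$ vertices (the pendent vertices) and no other edges. For $n\ge 4$ and $1\le k\le n-2$, $H_{n,k}$ is the graph obtained from $S_n$ by fixing one pendent vertex $u$ and adding $k$ edges joining $u$ to $k$ other pendent vertices of $S_n$; also $H_{n,0}=S_n$. *)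

theory Defs
  imports Graph_Theory.Graph_Theory "HOL-Library.Uprod"
begin

text \<open>
  A finite simple graph is a \<^locale>\<open>pair_graph\<close>: a finite, loop-free, symmetric set of pairs,
  in which an undirected edge \<open>uv\<close> is represented by the two arcs \<open>(u, v)\<close> and \<open>(v, u)\<close>.
\<close>

definition edge_set :: "'a pair_pre_digraph \<Rightarrow> 'a uprod set" where
  "edge_set G = (\<lambda>(u, v). Upair u v) ` parcs G"

text \<open>By symmetry, the out-degree of a vertex is its number of neighbours.\<close>

definition deg :: "'a pair_pre_digraph \<Rightarrow> 'a \<Rightarrow> nat" where
  "deg G w = out_degree (with_proj G) w"

text \<open>
  \<open>(d\<^sub>u - d\<^sub>v)\<^sup>2\<close> as a commutative function of \<open>u\<close> and \<open>v\<close>, so that it can be applied to an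
  unordered pair. The difference is taken in the integers.
\<close>

lift_definition sq_diff :: "('a \<Rightarrow> nat) \<Rightarrow> ('a, int) commute" is
  "\<lambda>d u v. (int (d u) - int (d v))\<^sup>2"
  by (rule power2_commute)

definition sigma_index :: "'a pair_pre_digraph \<Rightarrow> int" where
  "sigma_index G = (\<Sum>e\<in>edge_set G. case_uprod (sq_diff (deg G)) e)"

lemma case_uprod_sq_diff [simp]:
  "case_uprod (sq_diff d) (Upair u v) = (int (d u) - int (d v))\<^sup>2"
  by transfer simp

definition connected_cyclic :: "nat \<Rightarrow> 'a pair_pre_digraph \<Rightarrow> bool" where
  "connected_cyclic k G \<longleftrightarrow>
     pair_graph G \<and> connected (with_proj G) \<and>
     card (edge_set G) = card (pverts G) + k - 1"

text \<open>
  The star on \<open>{0, \<dots>, n - 1}\<close> has centre \<open>0\<close>. In \<open>H_graph n k\<close> the fixed pendent vertex is \<open>1\<close>,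
  and it is joined to the \<open>k\<close> pendent vertices \<open>2, \<dots>, k + 1\<close>; these exist for \<open>k \<le> n - 2\<close>.
\<close>

definition star_graph :: "nat \<Rightarrow> nat pair_pre_digraph" where
  "star_graph n = \<lparr>pverts = {0..<n},
     parcs = (\<Union>i\<in>{1..<n}. {(0, i), (i, 0)})\<rparr>"

definition H_graph :: "nat \<Rightarrow> nat \<Rightarrow> nat pair_pre_digraph" where
  "H_graph n k = \<lparr>pverts = pverts (star_graph n),
     parcs = parcs (star_graph n) \<union> (\<Union>i\<in>{2..<k + 2}. {(1, i), (i, 1)})\<rparr>"

lemma H_graph_0: "H_graph n 0 = star_graph n"
  by (simp add: H_graph_def)

lemma pair_graph_H_graph:
  assumes "k + 2 \<le> n"
  shows "pair_graph (H_graph n k)"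
  using assms
  by unfold_locales (auto simp: H_graph_def star_graph_def symmetric_def sym_def)

end

theory Submission
  imports Defs
begin

text \<open>
  Fix a vertex \<open>x\<close> of maximum degree \<open>a\<close>; \<open>k + r\<close> edges avoid it, where \<open>r = n - 1 - a\<close> is the
  number of its non-neighbours. The terms \<open>(a - d\<^sub>u)\<^sup>2\<close> of the edges at \<open>x\<close> are
  expanded around \<open>(a - 1)\<^sup>2\<close>, and their quadratic parts are distributed over the edges
  avoiding \<open>x\<close>, so that such an edge \<open>uv\<close> carries a weight of at most \<open>(p - q)\<^sup>2 + p + q\<close> with
  \<open>p = d\<^sub>u - 1\<close> and \<open>q = d\<^sub>v - 1\<close>.

  If \<open>r = 0\<close>, then \<open>p + q \<le> k + 1\<close> because only \<open>k\<close> edges avoid \<open>x\<close>. Hence the weight is at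
  most \<open>(k - 1)\<^sup>2 + k + 1\<close>, which is attained on every edge only when these edges form a star;
  this is the extremal graph.

  If \<open>r > 0\<close>, let \<open>b + 1\<close> be the largest degree of a vertex \<open>y \<noteq> x\<close>. All but at most \<open>r\<close> of the
  weights are at most \<open>b\<^sup>2 - b + 2\<close>, and \<open>y\<close> has many common neighbours with \<open>x\<close>, each of which
  lowers the contribution of an edge at \<open>x\<close>. The resulting polynomial bound is strictly smaller
  than the claimed one.
\<close>

section \<open>Polynomial inequalities\<close>

text \<open>A concave function lies above its chord, so positivity at both ends of an interval
  spreads to all of it.\<close>

lemma quadratic_pos_between:
  fixes b lo hi p q c :: int
  assumes "lo \<le> b" "b \<le> hi" "0 \<le> c"
    and lo: "0 < p + q * lo - c * lo\<^sup>2" and hi: "0 < p + q * hi - c * hi\<^sup>2"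
  shows "0 < p + q * b - c * b\<^sup>2"
proof (cases "lo = hi")
  case True
  then show ?thesis using assms by simp
next
  case False
  then have lohi: "lo < hi" using assms by simp
  define F where "F t = p + q * t - c * t\<^sup>2" for t
  \<comment> \<open>Chord interpolation cleared of denominators; the last summand is the surplus due
    to concavity.\<close>
  have "F b * (hi - lo) = (hi - b) * F lo + (b - lo) * F hi + c * ((b - lo) * (hi - b) * (hi - lo))"
    unfolding F_def by algebra
  moreover have "0 \<le> c * ((b - lo) * (hi - b) * (hi - lo))"
    using assms lohi by simp
  moreover have "0 < (hi - b) * F lo + (b - lo) * F hi"
  proof (cases "b = lo")
    case True
    then show ?thesis using lo lohi by (simp add: F_def)
  next
    case False
    have "0 < (b - lo) * F hi" using False assms(1) hi by (simp add: F_def)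
    moreover have "0 \<le> (hi - b) * F lo" using assms(2) lo by (simp add: F_def)
    ultimately show ?thesis by linarith
  qed
  ultimately have "0 < F b * (hi - lo)" by linarith
  then show ?thesis using lohi by (simp add: F_def zero_less_mult_iff)
qed

text \<open>
  The claimed bound minus the upper bound obtained when the root has degree \<open>a\<close>, there are \<open>r\<close> vertices
  not adjacent to it, all other vertices have degree at most \<open>b + 1\<close>, and \<open>s\<close> is the number of
  edge ends at neighbours of the root on edges avoiding the root.
\<close>

definition gap :: "int \<Rightarrow> int \<Rightarrow> int \<Rightarrow> int \<Rightarrow> int \<Rightarrow> int" where
  "gap a r k s b =
     (a + r) * (a + r - 1)\<^sup>2 - 2 * k * (2 * (a + r) - 3) + k\<^sup>2 * (k - 1)
     - (a * (a - 1)\<^sup>2 - 2 * (a - 1) * s + (k + r) * (b\<^sup>2 - b + 2) + r * (2 * b - 2))"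

text \<open>Along a line \<open>s = c * b + d\<close> the gap is a quadratic in \<open>b\<close>
  with leading coefficient \<open>- (k + r)\<close>, hence concave.\<close>

lemma gap_pos_between:
  assumes "lo \<le> b" "b \<le> hi" "0 \<le> k" "0 \<le> r"
    and "0 < gap a r k (c * lo + d) lo" "0 < gap a r k (c * hi + d) hi"
  shows "0 < gap a r k (c * b + d) b"
proof -
  define p where "p = gap a r k d 0"
  define q where "q = 2 * (a - 1) * c + (k + r) - 2 * r"
  have gap: "gap a r k (c * t + d) t = p + q * t - (k + r) * t\<^sup>2" for t
    unfolding gap_def p_def q_def by (simp add: algebra_simps)
  show ?thesis
    using quadratic_pos_between[of lo b hi "k + r" p q] assms by (simp add: gap)
qed

text \<open>The excluded point is a true exception, with value -2. Small \<open>k\<close> are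
  checked one by one; from \<open>k = 3\<close> on, completing the square in \<open>t\<close>
  works.\<close>

lemma cubic_pos:
  fixes t k :: int
  assumes "0 \<le> t" "0 \<le> k" "\<not> (t = 0 \<and> k = 2)"
  shows "0 < 3 * t\<^sup>2 + 12 * t + 10 + k ^ 3 - k\<^sup>2 - 4 * t * k - 8 * k"
proof -
  consider "k = 0" | "k = 1" | "k = 2" | "3 \<le> k" using assms(2) by linarith
  then show ?thesis
  proof cases
    case 1
    have "0 \<le> t\<^sup>2" by simp
    then have "0 < 3 * t\<^sup>2 + 12 * t + 10" using assms(1) by linarith
    then show ?thesis using 1 by simp
  next
    case 2
    have "0 \<le> t\<^sup>2" by simp
    then have "0 < 2 + (8 * t + 3 * t\<^sup>2)" using assms(1) by linarith
    then show ?thesis using 2 by simp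
  next
    case 3
    have "0 \<le> t\<^sup>2" by simp
    then have "2 < 4 * t + 3 * t\<^sup>2" using 3 assms by linarith
    then show ?thesis using 3 by simp
  next
    case 4
    have eq: "12 * (3 * t\<^sup>2 + 12 * t + 10 + k ^ 3 - k\<^sup>2 - 4 * t * k - 8 * k)
        = (6 * t + 12 - 4 * k)\<^sup>2 + (12 * k * k * (k - 3) + 8 * k * (k - 3) + 24 * k - 24)"
      by (simp add: algebra_simps power2_eq_square power3_eq_cube)
    have "0 \<le> 12 * k * k * (k - 3) + 8 * k * (k - 3)" using 4 by simp
    then have "0 < 12 * k * k * (k - 3) + 8 * k * (k - 3) + 24 * k - 24" using 4 by linarith
    then have "0 < 12 * (3 * t\<^sup>2 + 12 * t + 10 + k ^ 3 - k\<^sup>2 - 4 * t * k - 8 * k)"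
      unfolding eq by (intro add_nonneg_pos) simp_all
    then show ?thesis by (rule zero_less_mult_pos) simp
  qed
qed

text \<open>This settles the lower end of the range of \<open>b\<close> for both cases below. The
  gap grows with \<open>s\<close> because \<open>a\<close> exceeds 1, so \<open>s = 2 - r\<close> is
  the worst case.\<close>

lemma gap_at_1:
  assumes "2 \<le> a" "1 \<le> r" "0 \<le> k" "\<not> (a = 2 \<and> r = 1 \<and> k = 2)" "2 - r \<le> s"
  shows "0 < gap a r k s 1"
proof -
  obtain e f where ef: "a = 2 + int e" "r = 1 + int f"
    using that[of "nat (a - 2)" "nat (r - 1)"] assms(1,2) by simp
  \<comment> \<open>\<open>t\<close> is the order \<open>a + r + 1\<close> minus 4; it vanishes only
    for \<open>a = 2\<close> and \<open>r = 1\<close>.\<close>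
  define t where "t = int e + int f"
  have "0 < 3 * t\<^sup>2 + 12 * t + 10 + k ^ 3 - k\<^sup>2 - 4 * t * k - 8 * k"
    by (rule cubic_pos) (use assms in \<open>auto simp: t_def ef\<close>)
  moreover have "gap a r k (2 - r) 1
      = (3 * t\<^sup>2 + 12 * t + 10 + k ^ 3 - k\<^sup>2 - 4 * t * k - 8 * k)
        + int (3 * e * f\<^sup>2 + 3 * e\<^sup>2 * f + f ^ 3 + 6 * e * f + 4 * f\<^sup>2 + e)"
    unfolding gap_def ef t_def by (simp add: algebra_simps power2_eq_square power3_eq_cube)
  moreover have "gap a r k (2 - r) 1 \<le> gap a r k s 1"
    unfolding gap_def using assms(1,5) by (simp add: mult_left_mono)
  ultimately show ?thesis by linarith
qed

text \<open>
  By concavity in \<open>b\<close> it suffices to treat the two ends of the range of \<open>b\<close>. There, after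
  measuring every variable from its lower bound, (almost) all coefficients are nonnegative.
\<close>

lemma gap_pos_adjacent:
  assumes a: "2 \<le> a" and r: "1 \<le> r" and k: "0 \<le> k" "k \<le> a + r - 1"
    and b: "1 \<le> b" "b \<le> a - 1" "b \<le> k + r"
    and exc: "\<not> (a = 2 \<and> r = 1 \<and> k = 2)"
  shows "0 < gap a r k (2 * b - r) b"
proof -
  \<comment> \<open>The first limit comes from the maximum degree, the second from the number of
    edges avoiding the root.\<close>
  define hi where "hi = min (a - 1) (k + r)"
  have at1: "0 < gap a r k (2 * 1 + - r) 1" using gap_at_1 assms by simp
  have athi: "0 < gap a r k (2 * hi + - r) hi"
  proof -
    obtain g where g: "k = int g" using k(1) zero_le_imp_eq_int by blast
    \<comment> \<open>The cases decide which limit is active and, if it is \<open>a - 1\<close>,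
      whether \<open>k\<close> exceeds it. This fixes which differences are nonnegative and may
      serve as new variables.\<close>
    consider "k + r \<le> a - 1" | "a - 1 \<le> k + r" "k \<le> a - 1" | "a - 1 \<le> k + r" "a \<le> k"
      using r by linarith
    then show ?thesis
    proof cases
      case 1
      then obtain e f where s: "a = k + r + 1 + int e" "r = 1 + int f"
        using that[of "nat (a - 1 - k - r)" "nat (r - 1)"] r by simp
      have hi: "hi = k + r" using 1 by (simp add: hi_def)
      have "gap a r k (2 * hi + - r) hi = int (6*e*f*g + 9*e*f\<^sup>2 + 3*e\<^sup>2*f + 6*f\<^sup>2*g + 6*f^3 + 22*e*f
          + 6*e*g + 3*e\<^sup>2 + 12*f*g + 22*f\<^sup>2 + 13*e + 26*f + 6*g + 10)"
        unfolding gap_def hi s g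
        by (simp add: algebra_simps power2_eq_square power3_eq_cube)
      then show ?thesis by (simp only: of_nat_0_less_iff)
    next
      case 2
      then obtain d e where s: "a = k + 1 + int d" "r = int d + int e"
        using that[of "nat (a - 1 - k)" "nat (r - (a - 1 - k))"] by simp
      have hi: "hi = a - 1" using 2 by (simp add: hi_def)
      have gap: "gap a r k (2 * hi + - r) hi
          = int (10*d*e*g + 6*d*e\<^sup>2 + 11*d\<^sup>2*e + 6*d\<^sup>2*g + 6*d^3 + e^3 + d*e + 4*d\<^sup>2 + e\<^sup>2)
            + int (e * g) * (3 * int e + 2 * k - 5)"
        unfolding gap_def hi s g
        by (simp add: algebra_simps power2_eq_square power3_eq_cube)
      have "0 < d \<or> 0 < e" using s(2) r by linarith
      then have "0 < 10*d*e*g + 6*d*e\<^sup>2 + 11*d\<^sup>2*e + 6*d\<^sup>2*g + 6*d^3 + e^3 + d*e + 4*d\<^sup>2 + e\<^sup>2"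
        by auto
      \<comment> \<open>If neither \<open>e\<close> nor \<open>g\<close> is 0, then
        \<open>3 * e + 2 * k\<close> is at least 5.\<close>
      moreover have "0 \<le> int (e * g) * (3 * int e + 2 * k - 5)"
        by (cases "e = 0 \<or> g = 0") (auto simp: g)
      ultimately show ?thesis unfolding gap by linarith
    next
      case 3
      then obtain e h f where s: "k = a + int f" "r = int f + 1 + int e" "a = 2 + int h"
        using that[of "nat (k - a)" "nat (r - 1 - (k - a))" "nat (a - 2)"] a k(2) by simp
      have hi: "hi = a - 1" using 3 by (simp add: hi_def)
      have gap: "gap a r k (2 * hi + - r) hi
          = int (6*e*f*h + 3*e*f\<^sup>2 + 2*e*h\<^sup>2 + 3*e\<^sup>2*f + 3*e\<^sup>2*h + e^3 + 4*f*h\<^sup>2 + 6*f\<^sup>2*h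
            + 2*f^3 + 10*e*f + 5*e*h + 7*e\<^sup>2 + 10*f*h + 8*f\<^sup>2 + 4*h\<^sup>2) + (4 * int (e + f + h) - 2)"
        unfolding gap_def hi s
        by (simp add: algebra_simps power2_eq_square power3_eq_cube)
      \<comment> \<open>\<open>e = f = h = 0\<close> is exactly the triple excluded by
        \<open>exc\<close>.\<close>
      have "0 < 4 * int (e + f + h) - 2" using exc s by auto
      then show ?thesis unfolding gap by linarith
    qed
  qed
  show ?thesis
    using gap_pos_between[OF b(1) _ k(1) _ at1 athi] b r by (simp add: hi_def)
qed

text \<open>All \<open>b + 1\<close> edges at a vertex not adjacent to the root avoid the root, so
  the upper limit drops to \<open>k + r - 1\<close>. Otherwise the scheme is that of
  \<open>gap_pos_adjacent\<close>.\<close>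

lemma gap_pos_nonadjacent:
  assumes a: "2 \<le> a" and r: "1 \<le> r" and k: "0 \<le> k" "k \<le> a + r - 1"
    and b: "1 \<le> b" "b \<le> a - 1" "b + 1 \<le> k + r"
    and exc: "\<not> (a = 2 \<and> r = 1 \<and> k = 2)"
  shows "0 < gap a r k (b + 2 - r) b"
proof -
  define hi where "hi = min (a - 1) (k + r - 1)"
  have at1: "0 < gap a r k (1 * 1 + (2 - r)) 1" using gap_at_1 assms by simp
  have athi: "0 < gap a r k (1 * hi + (2 - r)) hi"
  proof -
    obtain g where g: "k = int g" using k(1) zero_le_imp_eq_int by blast
    consider "k + r \<le> a" | "a \<le> k + r - 1" "k \<le> a - 1" | "a - 1 \<le> k + r - 1" "a \<le> k"
      using r by linarith
    then show ?thesis
    proof cases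
      case 1
      then obtain e f where s: "a = k + r + int e" "r = 1 + int f"
        using that[of "nat (a - k - r)" "nat (r - 1)"] r by simp
      have hi: "hi = k + r - 1" using 1 by (simp add: hi_def)
      have "gap a r k (1 * hi + (2 - r)) hi = int (6*e*f*g + 9*e*f\<^sup>2 + 3*e\<^sup>2*f + 6*f\<^sup>2*g + 6*f^3 + 14*e*f
          + 4*e*g + 3*e\<^sup>2 + 6*f*g + 13*f\<^sup>2 + 7*e + 11*f + 2*g + 2)"
        unfolding gap_def hi s g
        by (simp add: algebra_simps power2_eq_square power3_eq_cube)
      then show ?thesis by (simp only: of_nat_0_less_iff)
    next
      case 2
      then obtain d e where s: "a = k + 1 + int d" "r = int d + 1 + int e"
        using that[of "nat (a - 1 - k)" "nat (r - 1 - (a - 1 - k))"] by simp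
      have hi: "hi = a - 1" using 2 by (simp add: hi_def)
      have "gap a r k (1 * hi + (2 - r)) hi
          = int (10*d*e*g + 6*d*e\<^sup>2 + 11*d\<^sup>2*e + 6*d\<^sup>2*g + 6*d^3 + 2*e*g\<^sup>2 + 3*e\<^sup>2*g + e^3
            + 13*d*e + 6*d*g + 13*d\<^sup>2 + e*g + 4*e\<^sup>2 + 11*d + 5*e + 2*g + 2)"
        unfolding gap_def hi s g
        by (simp add: algebra_simps power2_eq_square power3_eq_cube)
      then show ?thesis by (simp only: of_nat_0_less_iff)
    next
      case 3
      then obtain e h f where s: "k = a + int f" "r = int f + 1 + int e" "a = 2 + int h"
        using that[of "nat (k - a)" "nat (r - 1 - (k - a))" "nat (a - 2)"] a k(2) by simp
      have hi: "hi = a - 1" using 3 by (simp add: hi_def)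
      have gap: "gap a r k (1 * hi + (2 - r)) hi
          = int (6*e*f*h + 3*e*f\<^sup>2 + 2*e*h\<^sup>2 + 3*e\<^sup>2*f + 3*e\<^sup>2*h + e^3 + 4*f*h\<^sup>2 + 6*f\<^sup>2*h
            + 2*f^3 + 10*e*f + 5*e*h + 7*e\<^sup>2 + 10*f*h + 8*f\<^sup>2 + 2*h\<^sup>2) + 4 * int (e + f + h)"
        unfolding gap_def hi s
        by (simp add: algebra_simps power2_eq_square power3_eq_cube)
      have "0 < 4 * int (e + f + h)" using exc s by auto
      then show ?thesis unfolding gap by linarith
    qed
  qed
  show ?thesis
    using gap_pos_between[OF b(1) _ k(1) _ at1 athi] b r by (simp add: hi_def algebra_simps)
qed

text \<open>\<open>(p - q)\<^sup>2\<close> and \<open>p + q\<close> are bounded separately, by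
  \<open>(k - 1)\<^sup>2\<close> and \<open>k + 1\<close>; equality needs both bounds to be
  attained, which leaves only the values 1 and \<open>k\<close>.\<close>

lemma weight_le_star:
  fixes p q k :: int
  assumes "1 \<le> p" "1 \<le> q" "p + q \<le> k + 1"
  shows "(p - q)\<^sup>2 + p + q \<le> k\<^sup>2 - k + 2"
    and "(p - q)\<^sup>2 + p + q = k\<^sup>2 - k + 2 \<Longrightarrow> p = k \<and> q = 1 \<or> p = 1 \<and> q = k"
proof -
  have k: "k\<^sup>2 - k + 2 = (k - 1)\<^sup>2 + (k + 1)" by (simp add: power2_eq_square algebra_simps)
  have "\<bar>p - q\<bar> \<le> k - 1" using assms by linarith
  then have le: "(p - q)\<^sup>2 \<le> (k - 1)\<^sup>2"
    using abs_le_square_iff[of "p - q" "k - 1"] by simp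
  then show "(p - q)\<^sup>2 + p + q \<le> k\<^sup>2 - k + 2" using assms(3) unfolding k by linarith
  assume "(p - q)\<^sup>2 + p + q = k\<^sup>2 - k + 2"
  then have "p + q = k + 1" "(p - q)\<^sup>2 = (k - 1)\<^sup>2" using le assms(3) unfolding k by linarith+
  then show "p = k \<and> q = 1 \<or> p = 1 \<and> q = k" unfolding power2_eq_iff by linarith
qed

lemma weight_le_box:
  fixes p q b :: int
  assumes "1 \<le> p" "p \<le> b" "1 \<le> q" "q \<le> b"
  shows "(p - q)\<^sup>2 + p + q \<le> b\<^sup>2 - b + 2"
proof -
  have main: "(s - t)\<^sup>2 + s + t \<le> b\<^sup>2 - b + 2" if "s \<le> b" "1 \<le> t" "t \<le> s" for s t
  proof -
    have "0 \<le> (b - 1 - (s - t)) * (b - 2 + (s - t))"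
    \<comment> \<open>Integrality matters: if the first factor is nonzero, then \<open>b\<close> is
      at least 2 and the second factor is nonnegative.\<close>
    proof (cases "b - 1 = s - t")
      case False
      then show ?thesis using that by (intro mult_nonneg_nonneg) linarith+
    qed simp
    also have "\<dots> = b\<^sup>2 - b + 2 - ((s - t)\<^sup>2 + s + t) - 2 * (b - s)"
      by (simp add: power2_eq_square algebra_simps)
    finally have "(s - t)\<^sup>2 + s + t + 2 * (b - s) \<le> b\<^sup>2 - b + 2" by simp
    moreover have "(s - t)\<^sup>2 + s + t \<le> (s - t)\<^sup>2 + s + t + 2 * (b - s)" using that(1) by simp
    ultimately show ?thesis by (rule order_trans[rotated])
  qed
  show ?thesis
    using main[of p q] main[of q p] assms by (cases "q \<le> p") (simp_all add: power2_commute)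
qed

text \<open>An end with value 0 can push the weight up to \<open>b\<^sup>2 + b\<close>, which
  exceeds the box bound by exactly \<open>2 * b - 2\<close>; this surplus is charged to each such
  end.\<close>

lemma weight_le_box_0:
  fixes p q b :: int
  assumes "1 \<le> b" "0 \<le> p" "p \<le> b" "0 \<le> q" "q \<le> b"
  shows "(p - q)\<^sup>2 + p + q \<le> b\<^sup>2 - b + 2 + (2 * b - 2) * (of_bool (p = 0) + of_bool (q = 0))"
proof -
  have sq: "t\<^sup>2 + t \<le> b\<^sup>2 - b + 2 + (2 * b - 2)" if "0 \<le> t" "t \<le> b" for t
    using add_mono[OF power_mono[of t b 2] that(2)] that by simp
  have "(1 :: int) \<le> b\<^sup>2" using assms(1) by simp
  then have zero: "0 \<le> b\<^sup>2 - b + 2 + ((2 * b - 2) + (2 * b - 2))" using assms(1) by linarith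
  consider "p = 0" "q = 0" | "p = 0" "1 \<le> q" | "1 \<le> p" "q = 0" | "1 \<le> p" "1 \<le> q"
    using assms by linarith
  then show ?thesis
  proof cases
    case 1
    then show ?thesis using zero by (simp add: algebra_simps)
  next
    case 2
    then show ?thesis using sq[of q] assms by simp
  next
    case 3
    then show ?thesis using sq[of p] assms by simp
  next
    case 4
    then show ?thesis using weight_le_box[of p b q] assms by simp
  qed
qed

section \<open>Sums over arcs\<close>

lemma card_star_union:
  assumes "finite Z" "u \<notin> Z"
  shows "card ({u} \<times> Z \<union> Z \<times> {u}) = 2 * card Z"
  using assms by (subst card_Un_disjoint) (auto simp: card_cartesian_product)

text \<open>The edges at \<open>u\<close> and the edges at \<open>v\<close> share only the edge
  \<open>uv\<close>. Every edge counts as two arcs.\<close>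

lemma card_two_rows_le:
  assumes "finite B" "sym B" "irrefl B" "(u, v) \<in> B"
  shows "2 * (card (B `` {u}) + card (B `` {v})) \<le> card B + 2"
proof -
  have fin: "finite (B `` {w})" for w using assms(1) by (rule finite_Image)
  have uv: "u \<noteq> v" "(v, u) \<in> B" using assms by (auto simp: irrefl_def dest: symD)
  let ?P = "{u} \<times> B `` {u} \<union> B `` {u} \<times> {u}"
  let ?Q = "{v} \<times> (B `` {v} - {u}) \<union> (B `` {v} - {u}) \<times> {v}"
  have P: "card ?P = 2 * card (B `` {u})"
    by (rule card_star_union) (use fin assms(3) in \<open>auto simp: irrefl_def\<close>)
  have Q: "card ?Q = 2 * card (B `` {v} - {u})"
    by (rule card_star_union) (use fin assms(3) in \<open>auto simp: irrefl_def\<close>)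
  have "card (B `` {v}) = Suc (card (B `` {v} - {u}))"
    using uv fin by (intro card.remove) auto
  moreover have "card (?P \<union> ?Q) = card ?P + card ?Q"
    by (rule card_Un_disjoint) (use fin uv in auto)
  moreover have "card (?P \<union> ?Q) \<le> card B"
    by (rule card_mono) (use assms in \<open>auto dest: symD\<close>)
  ultimately show ?thesis using P Q by simp
qed

lemma card_row_le:
  assumes "finite B" "sym B" "irrefl B"
  shows "2 * card (B `` {u}) \<le> card B"
proof -
  have "2 * card (B `` {u}) = card ({u} \<times> B `` {u} \<union> B `` {u} \<times> {u})"
    by (rule card_star_union[symmetric])
      (use finite_Image[OF assms(1)] assms(3) in \<open>auto simp: irrefl_def\<close>)
  also have "\<dots> \<le> card B"
    by (rule card_mono) (use assms in \<open>auto dest: symD\<close>)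
  finally show ?thesis .
qed

lemma eq_star_if_card_row:
  assumes "finite B" "sym B" "irrefl B" "2 * card (B `` {u}) = card B"
  shows "B = {u} \<times> B `` {u} \<union> B `` {u} \<times> {u}"
proof (rule card_subset_eq[symmetric])
  show "card ({u} \<times> B `` {u} \<union> B `` {u} \<times> {u}) = card B"
    unfolding assms(4)[symmetric]
    by (rule card_star_union) (use finite_Image[OF assms(1)] assms(3) in \<open>auto simp: irrefl_def\<close>)
qed (use assms in \<open>auto dest: symD\<close>)

lemma sum_fst_image:
  fixes h :: "'a \<Rightarrow> int"
  assumes "finite V" "finite B" "B \<subseteq> V \<times> UNIV"
  shows "(\<Sum>(u, v)\<in>B. h u) = (\<Sum>u\<in>V. int (card (B `` {u})) * h u)"
proof -
  have B: "B = Sigma V (\<lambda>u. B `` {u})" using assms(3) by auto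
  have fin: "finite (B `` {u})" for u using assms(2) by (rule finite_Image)
  have "(\<Sum>(u, v)\<in>Sigma V (\<lambda>u. B `` {u}). h u) = (\<Sum>u\<in>V. \<Sum>v\<in>B `` {u}. h u)"
    using assms(1) fin by (subst sum.Sigma) auto
  then show ?thesis using B by simp
qed

lemma sum_swap_sym:
  assumes "sym B"
  shows "(\<Sum>(u, v)\<in>B. f u v) = (\<Sum>(u, v)\<in>B. f v u)"
  by (rule sum.reindex_bij_witness[where i = prod.swap and j = prod.swap])
    (use assms in \<open>auto dest: symD\<close>)

section \<open>Degrees and edge sums expressed by arcs\<close>

context pair_graph
begin

lemma deg_eq_card: "deg G u = card (parcs G `` {u})"
proof -
  have "out_arcs (with_proj G) u = Pair u ` (parcs G `` {u})"
    by (auto simp: out_arcs_def)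
  then show ?thesis
    by (simp add: deg_def out_degree_def card_image inj_on_def)
qed

lemma finite_nbrs: "finite (parcs G `` {u})"
  using pair_finite_arcs by (rule finite_Image)

text \<open>Every fibre of the map from arcs to edges consists of two opposite arcs, distinct
  because there are no loops.\<close>

lemma sum_arcs_eq_twice_edges:
  fixes g :: "'a uprod \<Rightarrow> 'b :: semiring_1"
  shows "(\<Sum>(u, v)\<in>parcs G. g (Upair u v)) = 2 * (\<Sum>e\<in>edge_set G. g e)"
proof -
  let ?p = "\<lambda>(u, v). Upair u v"
  have fibre: "(\<Sum>a\<in>{a \<in> parcs G. ?p a = e}. g (?p a)) = 2 * g e" if e: "e \<in> edge_set G" for e
  proof -
    obtain u v where uv: "e = Upair u v" "(u, v) \<in> parcs G"
      using e by (auto simp: edge_set_def)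
    then have "{a \<in> parcs G. ?p a = e} = {(u, v), (v, u)}" "u \<noteq> v"
      using arcs_symmetric no_loops' by auto
    then have "(\<Sum>a\<in>{a \<in> parcs G. ?p a = e}. g (?p a)) = g (Upair u v) + g (Upair v u)"
      using uv by simp
    moreover have "Upair v u = e" using uv by (simp add: Upair_inject)
    ultimately show ?thesis using uv(1) by (simp only: mult_2)
  qed
  have "(\<Sum>(u, v)\<in>parcs G. g (Upair u v)) = (\<Sum>a\<in>parcs G. g (?p a))"
    by (simp add: case_prod_unfold)
  also have "\<dots> = (\<Sum>e\<in>?p ` parcs G. \<Sum>a\<in>{a \<in> parcs G. ?p a = e}. g (?p a))"
    using pair_finite_arcs by (rule sum.image_gen)
  also have "\<dots> = (\<Sum>e\<in>edge_set G. 2 * g e)"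
    using fibre by (intro sum.cong) (auto simp: edge_set_def)
  finally show ?thesis by (simp add: sum_distrib_left)
qed

lemma card_arcs_eq_twice_edges: "card (parcs G) = 2 * card (edge_set G)"
  using sum_arcs_eq_twice_edges[of "\<lambda>_. 1 :: nat"] by simp

lemma twice_sigma_index:
  "2 * sigma_index G = (\<Sum>(u, v)\<in>parcs G. (int (deg G u) - int (deg G v))\<^sup>2)"
  unfolding sigma_index_def sum_arcs_eq_twice_edges[symmetric]
  by (simp only: case_uprod_sq_diff)

lemma sum_deg: "(\<Sum>u\<in>pverts G. deg G u) = card (parcs G)"
proof -
  have "parcs G \<subseteq> pverts G \<times> UNIV" using in_arcsD1 by auto
  from sum_fst_image[OF pair_finite_verts pair_finite_arcs this, of "\<lambda>_. 1"]
  have "int (\<Sum>u\<in>pverts G. deg G u) = int (card (parcs G))"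
    by (simp add: deg_eq_card case_prod_unfold)
  then show ?thesis by (simp only: of_nat_eq_iff)
qed

end

section \<open>Splitting the edges at a root vertex\<close>

locale rooted_graph = pair_graph G for G :: "'a pair_pre_digraph" +
  fixes x :: 'a
  assumes root: "x \<in> pverts G"
begin

definition nbrs :: "'a set" where "nbrs = parcs G `` {x}"

definition off :: "('a \<times> 'a) set" where "off = {(u, v) \<in> parcs G. u \<noteq> x \<and> v \<noteq> x}"

text \<open>For a neighbour of the root this counts its edges avoiding the root; for the root itself
  it is the \<open>a - 1\<close> of the polynomial bounds.\<close>

definition excess :: "'a \<Rightarrow> int" where "excess u = int (deg G u) - 1"

lemma finite_off: "finite off"
  unfolding off_def by (rule finite_subset[OF _ pair_finite_arcs]) auto

lemma sym_off: "sym off"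
  using arcs_symmetric by (auto simp: off_def intro: symI)

lemma off_subset: "off \<subseteq> (pverts G - {x}) \<times> (pverts G - {x})"
  using in_arcsD1 in_arcsD2 by (auto simp: off_def)

lemma finite_nbrs_root: "finite nbrs"
  by (simp add: nbrs_def finite_nbrs)

lemma nbrs_subset: "nbrs \<subseteq> pverts G - {x}"
  using in_arcsD2 no_loops' by (auto simp: nbrs_def)

lemma card_nbrs: "int (card nbrs) = excess x + 1"
  by (simp add: nbrs_def excess_def deg_eq_card)

lemma sum_arcs_split:
  "(\<Sum>(u, v)\<in>parcs G. f u v) = (\<Sum>v\<in>nbrs. f x v) + (\<Sum>v\<in>nbrs. f v x) + (\<Sum>(u, v)\<in>off. f u v)"
proof -
  have eq: "parcs G = (Pair x ` nbrs \<union> (\<lambda>v. (v, x)) ` nbrs) \<union> off"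
    using arcs_symmetric by (auto simp: nbrs_def off_def)
  have disj: "Pair x ` nbrs \<inter> (\<lambda>v. (v, x)) ` nbrs = {}"
    "(Pair x ` nbrs \<union> (\<lambda>v. (v, x)) ` nbrs) \<inter> off = {}"
    using nbrs_subset by (auto simp: off_def)
  show ?thesis
    by (subst eq, subst sum.union_disjoint)
      (use disj finite_off finite_nbrs_root in
        \<open>auto simp: sum.union_disjoint sum.reindex inj_on_def\<close>)
qed

lemma card_arcs: "card (parcs G) = 2 * card nbrs + card off"
  using sum_arcs_split[of "\<lambda>_ _. 1 :: nat"] by (simp add: case_prod_unfold)

lemma card_off_row:
  assumes "u \<in> pverts G" "u \<noteq> x"
  shows "int (card (off `` {u})) = excess u + of_bool (u \<notin> nbrs)"
proof -
  have "parcs G `` {u} = off `` {u} \<union> (if u \<in> nbrs then {x} else {})"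
    using assms arcs_symmetric by (auto simp: off_def nbrs_def)
  moreover have "x \<notin> off `` {u}" "finite (off `` {u})"
    using finite_Image[OF finite_off, of "{u}"] by (simp_all add: off_def)
  ultimately have "card (parcs G `` {u}) = card (off `` {u}) + of_bool (u \<in> nbrs)"
    by simp
  then show ?thesis by (simp add: excess_def deg_eq_card)
qed

text \<open>Double counting: a neighbour \<open>u\<close> of the root is the tail of
  \<open>excess u\<close> arcs in \<open>off\<close>.\<close>

lemma sum_off_nbrs:
  "(\<Sum>(u, v)\<in>off. of_bool (u \<in> nbrs) * h u) = (\<Sum>u\<in>nbrs. excess u * h u)" for h :: "'a \<Rightarrow> int"
proof -
  have "(\<Sum>(u, v)\<in>off. of_bool (u \<in> nbrs) * h u)
      = (\<Sum>u\<in>pverts G - {x}. int (card (off `` {u})) * (of_bool (u \<in> nbrs) * h u))"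
    by (rule sum_fst_image) (use off_subset pair_finite_verts finite_off in auto)
  also have "\<dots> = (\<Sum>u\<in>pverts G - {x}. if u \<in> nbrs then excess u * h u else 0)"
    by (rule sum.cong) (auto simp: card_off_row)
  also have "\<dots> = (\<Sum>u\<in>nbrs. excess u * h u)"
    using nbrs_subset pair_finite_verts by (subst sum.inter_restrict[symmetric]) (auto intro: sum.cong)
  finally show ?thesis .
qed

text \<open>
  The arcs avoiding the root absorb the quadratic terms \<open>(excess u)\<^sup>2\<close> of
  \<open>(excess x - excess u)\<^sup>2\<close>, because a neighbour \<open>u\<close> of the root lies on exactly \<open>excess u\<close> of them.
\<close>

lemma sigma_index_rooted:
  "2 * sigma_index G = 2 * ((excess x + 1) * (excess x)\<^sup>2 - 2 * excess x * (\<Sum>u\<in>nbrs. excess u))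
     + (\<Sum>(u, v)\<in>off. (excess u - excess v)\<^sup>2
          + of_bool (u \<in> nbrs) * excess u + of_bool (v \<in> nbrs) * excess v)"
proof -
  let ?w = "\<lambda>u v. (excess u - excess v)\<^sup>2"
  have "2 * sigma_index G = (\<Sum>(u, v)\<in>parcs G. ?w u v)"
    by (simp add: twice_sigma_index excess_def)
  also have "\<dots> = 2 * (\<Sum>u\<in>nbrs. ?w x u) + (\<Sum>(u, v)\<in>off. ?w u v)"
    by (simp add: sum_arcs_split power2_commute)
  also have "(\<Sum>u\<in>nbrs. ?w x u)
      = (excess x + 1) * (excess x)\<^sup>2 - 2 * excess x * (\<Sum>u\<in>nbrs. excess u) + (\<Sum>u\<in>nbrs. excess u * excess u)"
    by (simp add: power2_diff sum.distrib sum_subtractf card_nbrs sum_distrib_left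
        flip: power2_eq_square)
  \<comment> \<open>One copy of the sum is charged to the tails of the arcs and, by symmetry of
    \<open>off\<close>, the other to the heads.\<close>
  moreover have "2 * (\<Sum>u\<in>nbrs. excess u * excess u)
      = (\<Sum>(u, v)\<in>off. of_bool (u \<in> nbrs) * excess u) + (\<Sum>(u, v)\<in>off. of_bool (v \<in> nbrs) * excess v)"
    using sum_swap_sym[OF sym_off, of "\<lambda>u v. of_bool (u \<in> nbrs) * excess u"] by (simp add: sum_off_nbrs)
  ultimately show ?thesis
    by (simp add: sum.distrib case_prod_unfold algebra_simps)
qed

end

section \<open>A vertex adjacent to all others\<close>

context rooted_graph
begin

lemma irrefl_off: "irrefl off"
  using no_loops' by (auto simp: irrefl_def off_def)

lemma sum_excess_dominating:
  assumes "nbrs = pverts G - {x}"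
  shows "(\<Sum>u\<in>nbrs. excess u) = int (card off)"
proof -
  have "(\<Sum>u\<in>nbrs. excess u) = (\<Sum>(u, v)\<in>off. of_bool (u \<in> nbrs))"
    using sum_off_nbrs[of "\<lambda>_. 1"] by simp
  also have "\<dots> = (\<Sum>(u, v)\<in>off. 1)"
    by (rule sum.cong) (use assms off_subset in auto)
  finally show ?thesis by (simp add: case_prod_unfold)
qed

lemma excess_dominating:
  assumes "nbrs = pverts G - {x}" "(u, v) \<in> off"
  shows "excess u = int (card (off `` {u}))" "excess v = int (card (off `` {v}))"
proof -
  have "u \<in> pverts G" "u \<noteq> x" "v \<in> pverts G" "v \<noteq> x" using assms(2) off_subset by auto
  then show "excess u = int (card (off `` {u}))" "excess v = int (card (off `` {v}))"
    using card_off_row[of u] card_off_row[of v] assms(1) by simp_all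
qed

lemma twice_sigma_index_dominating:
  assumes dom: "nbrs = pverts G - {x}" and off: "card off = 2 * k"
  shows "2 * sigma_index G = 2 * ((excess x + 1) * (excess x)\<^sup>2 - 4 * excess x * int k)
     + (\<Sum>(u, v)\<in>off. (excess u - excess v)\<^sup>2 + excess u + excess v)"
proof -
  have "(\<Sum>(u, v)\<in>off. (excess u - excess v)\<^sup>2
          + of_bool (u \<in> nbrs) * excess u + of_bool (v \<in> nbrs) * excess v)
      = (\<Sum>(u, v)\<in>off. (excess u - excess v)\<^sup>2 + excess u + excess v)"
    by (rule sum.cong) (use dom off_subset in auto)
  then show ?thesis
    by (simp add: sigma_index_rooted sum_excess_dominating[OF dom] off)
qed

lemma dominating_weight:
  assumes dom: "nbrs = pverts G - {x}" and off: "card off = 2 * k" and uv: "(u, v) \<in> off"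
  shows "1 \<le> excess u" "1 \<le> excess v" "excess u + excess v \<le> int k + 1"
proof -
  have "(v, u) \<in> off" using uv sym_off by (auto dest: symD)
  then have "card (off `` {u}) \<noteq> 0" "card (off `` {v}) \<noteq> 0"
    using uv finite_Image[OF finite_off] by auto
  moreover have "card (off `` {u}) + card (off `` {v}) \<le> k + 1"
    using card_two_rows_le[OF finite_off sym_off irrefl_off uv] off by simp
  ultimately show "1 \<le> excess u" "1 \<le> excess v" "excess u + excess v \<le> int k + 1"
    unfolding excess_dominating[OF dom uv] by linarith+
qed

text \<open>Twice the difference of the two sides is a sum of nonnegative slacks, one per arc in
  \<open>off\<close>; both claims are read off from it.\<close>

lemma sigma_index_dominating_le:
  assumes dom: "nbrs = pverts G - {x}" and off: "card off = 2 * k"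
  shows "sigma_index G \<le> (excess x + 1) * (excess x)\<^sup>2 - 4 * excess x * int k + int k * ((int k)\<^sup>2 - int k + 2)"
    and "sigma_index G = (excess x + 1) * (excess x)\<^sup>2 - 4 * excess x * int k + int k * ((int k)\<^sup>2 - int k + 2) \<longleftrightarrow>
      (\<forall>(u, v)\<in>off. (excess u - excess v)\<^sup>2 + excess u + excess v = (int k)\<^sup>2 - int k + 2)"
proof -
  let ?c = "(int k)\<^sup>2 - int k + 2"
  let ?rhs = "(excess x + 1) * (excess x)\<^sup>2 - 4 * excess x * int k + int k * ?c"
  let ?w = "\<lambda>(u, v). (excess u - excess v)\<^sup>2 + excess u + excess v"
  have le: "?w e \<le> ?c" if "e \<in> off" for e
    using that weight_le_star(1)[OF dominating_weight[OF dom off]] by (cases e) simp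
  have "(\<Sum>e\<in>off. ?c - ?w e) = 2 * int k * ?c - sum ?w off"
    by (simp add: sum_subtractf off)
  also have "\<dots> = 2 * (?rhs - sigma_index G)"
    using twice_sigma_index_dominating[OF dom off] by (simp add: ring_distribs)
  finally have slack: "(\<Sum>e\<in>off. ?c - ?w e) = 2 * (?rhs - sigma_index G)" .
  have nonneg: "0 \<le> (\<Sum>e\<in>off. ?c - ?w e)" using le by (intro sum_nonneg) simp
  have "sigma_index G = ?rhs \<longleftrightarrow> (\<Sum>e\<in>off. ?c - ?w e) = 0"
    unfolding slack by auto
  also have "(\<Sum>e\<in>off. ?c - ?w e) = 0 \<longleftrightarrow> (\<forall>e\<in>off. ?c - ?w e = 0)"
    using le finite_off by (intro sum_nonneg_eq_0_iff) auto
  also have "(\<forall>e\<in>off. ?c - ?w e = 0)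
      \<longleftrightarrow> (\<forall>(u, v)\<in>off. (excess u - excess v)\<^sup>2 + excess u + excess v = ?c)"
    by (intro ball_cong refl) (clarsimp, linarith)
  finally show "sigma_index G = ?rhs
      \<longleftrightarrow> (\<forall>(u, v)\<in>off. (excess u - excess v)\<^sup>2 + excess u + excess v = ?c)" .
  show "sigma_index G \<le> ?rhs" using nonneg unfolding slack by simp
qed

lemma sigma_index_dominating_eq_iff:
  assumes dom: "nbrs = pverts G - {x}" and off: "card off = 2 * k" and ne: "nbrs \<noteq> {}"
  shows "sigma_index G = (excess x + 1) * (excess x)\<^sup>2 - 4 * excess x * int k + int k * ((int k)\<^sup>2 - int k + 2)
    \<longleftrightarrow> (\<exists>y\<in>nbrs. \<exists>Z\<subseteq>nbrs - {y}. card Z = k \<and> off = {y} \<times> Z \<union> Z \<times> {y})" (is "?L \<longleftrightarrow> ?R")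
proof
  assume ?L
  then have tight: "(excess u - excess v)\<^sup>2 + excess u + excess v = (int k)\<^sup>2 - int k + 2"
    if "(u, v) \<in> off" for u v
    using that sigma_index_dominating_le(2)[OF dom off] by auto
  show ?R
  proof (cases "off = {}")
    \<comment> \<open>Here \<open>k = 0\<close>: any neighbour serves as \<open>y\<close>, with
      \<open>Z\<close> empty.\<close>
    case True
    then show ?thesis using ne off by auto
  next
    case False
    then obtain u v where uv: "(u, v) \<in> off" by auto
    have "excess u = int k \<or> excess v = int k"
      using weight_le_star(2)[OF dominating_weight[OF dom off uv] tight[OF uv]] by auto
    \<comment> \<open>The arcs at \<open>y\<close> and their reversals already number
      \<open>2 * k\<close>, so they exhaust \<open>off\<close>.\<close>
    then obtain y where y: "y \<in> {u, v}" "card (off `` {y}) = k"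
      unfolding excess_dominating[OF dom uv] by auto
    have "y \<in> nbrs" using y uv off_subset dom by auto
    moreover have "off `` {y} \<subseteq> nbrs - {y}"
      using off_subset dom irrefl_off by (auto simp: irrefl_def)
    moreover have "off = {y} \<times> off `` {y} \<union> off `` {y} \<times> {y}"
      by (rule eq_star_if_card_row) (use finite_off sym_off irrefl_off y off in auto)
    ultimately show ?thesis using y by blast
  qed
next
  assume ?R
  then obtain y Z where yZ: "y \<in> nbrs" "Z \<subseteq> nbrs - {y}" "card Z = k" "off = {y} \<times> Z \<union> Z \<times> {y}"
    by auto
  have row_y: "off `` {y} = Z" and row_Z: "\<And>z. z \<in> Z \<Longrightarrow> off `` {z} = {y}"
    using yZ by auto
  have "excess y = int k"
    using card_off_row[of y] row_y yZ dom by auto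
  moreover have "excess z = 1" if "z \<in> Z" for z
  proof -
    have "z \<in> nbrs" "z \<in> pverts G" "z \<noteq> x" using that yZ(2) dom by auto
    then show ?thesis using card_off_row[of z] row_Z[OF that] by simp
  qed
  ultimately have "(excess u - excess v)\<^sup>2 + excess u + excess v = (int k)\<^sup>2 - int k + 2"
    if "(u, v) \<in> off" for u v
    using that yZ(4) by (auto simp: power2_eq_square algebra_simps)
  then show ?L using sigma_index_dominating_le(2)[OF dom off] by auto
qed

end

section \<open>No vertex adjacent to all others\<close>

context rooted_graph
begin

definition far :: "'a set" where "far = pverts G - {x} - nbrs"

lemma finite_far: "finite far"
  using pair_finite_verts by (simp add: far_def)

lemma card_pverts: "int (card (pverts G)) = excess x + 2 + int (card far)"
proof -
  have "card (pverts G) = Suc (card (pverts G - {x}))"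
    using root pair_finite_verts by (intro card.remove) auto
  also have "card (pverts G - {x}) = card far + card nbrs"
    using nbrs_subset pair_finite_verts finite_nbrs_root card_mono[OF _ nbrs_subset]
    by (simp add: far_def card_Diff_subset)
  finally show ?thesis using card_nbrs by simp
qed

lemma excess_pos_if_off_row:
  assumes "u \<in> nbrs" "off `` {u} \<noteq> {}"
  shows "1 \<le> excess u"
proof -
  have "u \<in> pverts G" "u \<noteq> x" using assms(1) nbrs_subset by auto
  moreover have "card (off `` {u}) \<noteq> 0"
    using assms(2) finite_Image[OF finite_off] by simp
  ultimately show ?thesis using card_off_row[of u] assms(1) by simp
qed

text \<open>A common neighbour of \<open>x\<close> and \<open>y\<close> has an edge to
  \<open>y\<close> avoiding \<open>x\<close>, hence excess at least 1.\<close>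

lemma card_common_nbrs_le:
  assumes nonneg: "\<And>u. u \<in> nbrs \<Longrightarrow> 0 \<le> excess u"
  shows "int (card (nbrs \<inter> off `` {y})) \<le> (\<Sum>u\<in>nbrs - {y}. excess u)"
proof -
  have "int (card (nbrs \<inter> off `` {y})) = (\<Sum>u\<in>nbrs \<inter> off `` {y}. 1)" by simp
  also have "\<dots> \<le> (\<Sum>u\<in>nbrs \<inter> off `` {y}. excess u)"
    by (rule sum_mono, rule excess_pos_if_off_row) (use sym_off in \<open>auto dest: symD\<close>)
  also have "\<dots> \<le> (\<Sum>u\<in>nbrs - {y}. excess u)"
    by (rule sum_mono2) (use finite_nbrs_root nonneg irrefl_off in \<open>auto simp: irrefl_def\<close>)
  finally show ?thesis .
qed

text \<open>One \<open>excess y\<close> is the term of \<open>y\<close> itself. The other counts its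
  neighbours besides \<open>x\<close>, all of which, except those in \<open>far\<close>, are common
  neighbours.\<close>

lemma sum_excess_ge_adjacent:
  assumes nonneg: "\<And>u. u \<in> nbrs \<Longrightarrow> 0 \<le> excess u" and y: "y \<in> nbrs"
  shows "2 * excess y - int (card far) \<le> (\<Sum>u\<in>nbrs. excess u)"
proof -
  have "off `` {y} \<subseteq> nbrs \<inter> off `` {y} \<union> far"
    using off_subset by (auto simp: far_def)
  then have "card (off `` {y}) \<le> card (nbrs \<inter> off `` {y} \<union> far)"
    using finite_nbrs_root finite_far by (intro card_mono) auto
  also have "\<dots> \<le> card (nbrs \<inter> off `` {y}) + card far" by (rule card_Un_le)
  finally have "excess y \<le> int (card (nbrs \<inter> off `` {y})) + int (card far)"
    using card_off_row[of y] y nbrs_subset[THEN subsetD, OF y] by simp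
  moreover have "(\<Sum>u\<in>nbrs. excess u) = excess y + (\<Sum>u\<in>nbrs - {y}. excess u)"
    using finite_nbrs_root y by (rule sum.remove)
  ultimately show ?thesis using card_common_nbrs_le[OF nonneg, of y] by linarith
qed

text \<open>The 2 has two sources: \<open>y\<close> has \<open>excess y + 1\<close> neighbours, none
  of them \<open>x\<close>, and \<open>y\<close> itself takes up one place in
  \<open>far\<close>.\<close>

lemma sum_excess_ge_nonadjacent:
  assumes nonneg: "\<And>u. u \<in> nbrs \<Longrightarrow> 0 \<le> excess u" and y: "y \<in> far"
  shows "excess y + 2 - int (card far) \<le> (\<Sum>u\<in>nbrs. excess u)"
proof -
  have "off `` {y} \<subseteq> nbrs \<inter> off `` {y} \<union> (far - {y})"
    using off_subset irrefl_off by (auto simp: far_def irrefl_def)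
  then have "card (off `` {y}) \<le> card (nbrs \<inter> off `` {y} \<union> (far - {y}))"
    using finite_nbrs_root finite_far by (intro card_mono) auto
  also have "\<dots> \<le> card (nbrs \<inter> off `` {y}) + card (far - {y})" by (rule card_Un_le)
  finally have "excess y + 1 \<le> int (card (nbrs \<inter> off `` {y})) + int (card (far - {y}))"
    using card_off_row[of y] y by (simp add: far_def)
  moreover have "card far = Suc (card (far - {y}))" using finite_far y by (rule card.remove)
  moreover have "nbrs - {y} = nbrs" using y by (auto simp: far_def)
  ultimately show ?thesis using card_common_nbrs_le[OF nonneg, of y] by simp
qed

text \<open>A leaf adjacent to the root has no arc in \<open>off\<close>, so only leaves in
  \<open>far\<close> count, with one arc each.\<close>

lemma card_off_leaves_le:
  "(\<Sum>(u, v)\<in>off. of_bool (excess u = 0)) \<le> int (card far)"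
proof -
  have "(\<Sum>(u, v)\<in>off. of_bool (excess u = 0) :: int)
      = (\<Sum>u\<in>pverts G - {x}. int (card (off `` {u})) * of_bool (excess u = 0))"
    by (rule sum_fst_image) (use off_subset pair_finite_verts finite_off in auto)
  also have "\<dots> \<le> (\<Sum>u\<in>pverts G - {x}. of_bool (u \<in> far))"
    by (rule sum_mono) (auto simp: card_off_row far_def)
  also have "\<dots> = int (card far)"
  proof -
    have "(pverts G - {x}) \<inter> {u. u \<in> far} = far" by (auto simp: far_def)
    then show ?thesis using pair_finite_verts by (simp add: of_bool_def sum.If_cases)
  qed
  finally show ?thesis .
qed

lemma sigma_index_le_excess_bound:
  assumes b: "1 \<le> b" and bound: "\<And>u. u \<in> pverts G - {x} \<Longrightarrow> 0 \<le> excess u \<and> excess u \<le> b"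
  shows "2 * sigma_index G \<le> 2 * ((excess x + 1) * (excess x)\<^sup>2 - 2 * excess x * (\<Sum>u\<in>nbrs. excess u))
    + int (card off) * (b\<^sup>2 - b + 2) + 2 * int (card far) * (2 * b - 2)"
proof -
  let ?c = "b\<^sup>2 - b + 2" and ?d = "2 * b - 2"
  let ?leaf = "\<lambda>u. of_bool (excess u = 0) :: int"
  have "(\<Sum>(u, v)\<in>off. (excess u - excess v)\<^sup>2
          + of_bool (u \<in> nbrs) * excess u + of_bool (v \<in> nbrs) * excess v)
      \<le> (\<Sum>(u, v)\<in>off. ?c + ?d * (?leaf u + ?leaf v))"
  proof (rule sum_mono, clarify)
    fix u v assume "(u, v) \<in> off"
    then have "0 \<le> excess u" "excess u \<le> b" "0 \<le> excess v" "excess v \<le> b"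
      using bound off_subset by auto
    then show "(excess u - excess v)\<^sup>2 + of_bool (u \<in> nbrs) * excess u + of_bool (v \<in> nbrs) * excess v
        \<le> ?c + ?d * (?leaf u + ?leaf v)"
      using weight_le_box_0[OF b, of "excess u" "excess v"]
      by (cases "u \<in> nbrs"; cases "v \<in> nbrs"; simp only: of_bool_eq; linarith)
  qed
  also have "\<dots> = int (card off) * ?c + ?d * ((\<Sum>(u, v)\<in>off. ?leaf u) + (\<Sum>(u, v)\<in>off. ?leaf v))"
    by (simp add: sum.distrib case_prod_unfold flip: sum_distrib_left)
  also have "(\<Sum>(u, v)\<in>off. ?leaf v) = (\<Sum>(u, v)\<in>off. ?leaf u)"
    by (rule sum_swap_sym[OF sym_off])
  also have "int (card off) * ?c + ?d * ((\<Sum>(u, v)\<in>off. ?leaf u) + (\<Sum>(u, v)\<in>off. ?leaf u))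
      \<le> int (card off) * ?c + ?d * (int (card far) + int (card far))"
    using card_off_leaves_le b by (intro add_left_mono mult_left_mono add_mono) auto
  finally show ?thesis
    unfolding sigma_index_rooted by (simp add: algebra_simps)
qed

lemma card_off_eq:
  assumes "card (parcs G) + 2 = 2 * (card (pverts G) + k)"
  shows "card off = 2 * (k + card far)"
proof -
  have "card (pverts G) = card nbrs + card far + 1"
    using card_pverts card_nbrs by linarith
  then show ?thesis using assms card_arcs by simp
qed

lemma sigma_index_nondominating_less:
  assumes arcs: "card (parcs G) + 2 = 2 * (card (pverts G) + k)"
    and k: "k + 2 \<le> card (pverts G)"
    and deg_pos: "\<And>u. u \<in> pverts G \<Longrightarrow> 1 \<le> deg G u"
    and max: "\<And>u. u \<in> pverts G \<Longrightarrow> deg G u \<le> deg G x"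
    and far: "far \<noteq> {}"
  shows "sigma_index G < (int (card (pverts G)) - 1) * (int (card (pverts G)) - 2)\<^sup>2
    - 2 * int k * (2 * int (card (pverts G)) - 5) + (int k)\<^sup>2 * (int k - 1)"
proof -
  let ?V = "pverts G - {x}"
  define a r where "a = excess x + 1" and "r = int (card far)"
  have n: "int (card (pverts G)) = a + r + 1" using card_pverts by (simp add: a_def r_def)
  have r: "1 \<le> r" using far finite_far by (simp add: r_def Suc_le_eq card_gt_0_iff)
  have off: "int (card off) = 2 * (int k + r)" using card_off_eq[OF arcs] by (simp add: r_def)
  have nonneg: "0 \<le> excess u" if "u \<in> pverts G" for u
    using deg_pos[OF that] by (simp add: excess_def)
  have deg_sum: "(\<Sum>u\<in>pverts G. int (deg G u)) = 2 * (a + r + int k)"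
    using sum_deg arcs n by (simp flip: of_nat_sum)
  have "finite (excess ` ?V)" "excess ` ?V \<noteq> {}"
    using pair_finite_verts far by (auto simp: far_def)
  from Max_in[OF this] obtain y where y: "y \<in> ?V" and ymax: "excess y = Max (excess ` ?V)"
    by (metis imageE)
  have le_y: "excess u \<le> excess y" if "u \<in> ?V" for u
    using that pair_finite_verts unfolding ymax by (intro Max_ge) auto
  have b_le: "excess y \<le> a - 1" using max[of y] y by (simp add: a_def excess_def)
  \<comment> \<open>Otherwise the degree sum would be at most \<open>2 * a + r\<close>, too small
    for the number of edges.\<close>
  have b: "1 \<le> excess y"
  proof (rule ccontr)
    assume "\<not> 1 \<le> excess y"
    then have "int (deg G u) \<le> 1" if "u \<in> ?V" for u
      using le_y[OF that] by (simp add: excess_def)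
    then have "(\<Sum>u\<in>?V. int (deg G u)) \<le> (\<Sum>u\<in>?V. 1)" by (rule sum_mono)
    also have "\<dots> = a + r" using n card.remove[OF pair_finite_verts root] by simp
    finally have "(\<Sum>u\<in>pverts G. int (deg G u)) \<le> a + (a + r)"
      using sum.remove[OF pair_finite_verts root, of "\<lambda>u. int (deg G u)"]
      by (simp add: a_def excess_def)
    then show False using deg_sum r by simp
  qed
  \<comment> \<open>Such a graph would have 4 vertices and 5 edges, but maximum degree 2.\<close>
  have exc: "\<not> (a = 2 \<and> r = 1 \<and> int k = 2)"
  proof
    assume ark: "a = 2 \<and> r = 1 \<and> int k = 2"
    have "(\<Sum>u\<in>pverts G. int (deg G u)) \<le> (\<Sum>u\<in>pverts G. 2)"
      by (rule sum_mono) (use max ark in \<open>simp add: a_def excess_def\<close>)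
    then show False using deg_sum ark n by simp
  qed
  \<comment> \<open>This yields the upper limit on \<open>excess y\<close> in terms of
    \<open>k + r\<close> required by the gap lemmas.\<close>
  have row: "2 * int (card (off `` {y})) \<le> int (card off)"
    using card_row_le[OF finite_off sym_off irrefl_off, of y] by linarith
  have row_y: "int (card (off `` {y})) = excess y + of_bool (y \<notin> nbrs)"
    using y by (intro card_off_row) auto
  have nonneg_nbrs: "0 \<le> excess u" if "u \<in> nbrs" for u
    using nonneg that nbrs_subset by auto
  define s where "s = (\<Sum>u\<in>nbrs. excess u)"
  have mono: "gap a r (int k) t (excess y) \<le> gap a r (int k) s (excess y)" if "t \<le> s" for t
    using that b b_le by (simp add: gap_def mult_left_mono)
  have bounds: "2 \<le> a" "0 \<le> int k" "int k \<le> a + r - 1"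
    using b b_le k n by linarith+
  have "0 < gap a r (int k) s (excess y)"
  proof (cases "y \<in> nbrs")
    case True
    have "0 < gap a r (int k) (2 * excess y - r) (excess y)"
      using gap_pos_adjacent[OF bounds(1) r bounds(2,3) b b_le _ exc] row row_y True off by simp
    moreover have "2 * excess y - r \<le> s"
      unfolding s_def r_def using nonneg_nbrs True by (rule sum_excess_ge_adjacent)
    ultimately show ?thesis using mono by fastforce
  next
    case False
    then have "y \<in> far" using y by (simp add: far_def)
    have "0 < gap a r (int k) (excess y + 2 - r) (excess y)"
      using gap_pos_nonadjacent[OF bounds(1) r bounds(2,3) b b_le _ exc] row row_y False off by simp
    moreover have "excess y + 2 - r \<le> s"
      unfolding s_def r_def using nonneg_nbrs \<open>y \<in> far\<close> by (rule sum_excess_ge_nonadjacent)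
    ultimately show ?thesis using mono by fastforce
  qed
  moreover have "2 * sigma_index G \<le> 2 * (a * (a - 1)\<^sup>2 - 2 * (a - 1) * s
      + (int k + r) * ((excess y)\<^sup>2 - excess y + 2) + r * (2 * excess y - 2))"
    using sigma_index_le_excess_bound[OF b] nonneg le_y
    by (simp add: off a_def algebra_simps flip: s_def r_def)
  ultimately show ?thesis unfolding gap_def n by (simp add: algebra_simps)
qed

end

section \<open>The extremal graph\<close>

text \<open>With arcs being pairs on both sides, the head and tail maps are projections, which
  forces the arc map to be the vertex map applied to both components.\<close>

lemma digraph_iso_with_proj_iff:
  assumes "pair_wf_digraph G"
  shows "digraph_iso (with_proj G) (with_proj H) \<longleftrightarrow>
    (\<exists>f. inj_on f (pverts G) \<and> pverts H = f ` pverts G \<and> parcs H = map_prod f f ` parcs G)"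
    (is "?L \<longleftrightarrow> ?R")
proof
  assume ?L
  then obtain h where h: "pre_digraph.digraph_isomorphism (with_proj G) h"
    and H: "with_proj H = app_iso h (with_proj G)"
    by (auto simp: digraph_iso_def)
  let ?f = "iso_verts h"
  have tail: "iso_tail h = fst" and head: "iso_head h = snd"
    using arg_cong[OF H, of tail] arg_cong[OF H, of head] by simp_all
  have "iso_arcs h e = map_prod ?f ?f e" if "e \<in> parcs G" for e
    using h that unfolding pre_digraph.digraph_isomorphism_def tail head
    by (cases e) (auto simp: prod_eq_iff)
  then have "iso_arcs h ` parcs G = map_prod ?f ?f ` parcs G" by (rule image_cong[OF refl])
  then have "parcs H = map_prod ?f ?f ` parcs G" using arg_cong[OF H, of arcs] by simp
  moreover have "pverts H = ?f ` pverts G" using arg_cong[OF H, of verts] by simp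
  moreover have "inj_on ?f (pverts G)" using h by (simp add: pre_digraph.digraph_isomorphism_def)
  ultimately show ?R by blast
next
  assume ?R
  then obtain f where f: "inj_on f (pverts G)" "pverts H = f ` pverts G"
    "parcs H = map_prod f f ` parcs G" by blast
  interpret pair_wf_digraph G by fact
  let ?h = "\<lparr>iso_verts = f, iso_arcs = map_prod f f, iso_head = snd, iso_tail = fst\<rparr>"
  have "parcs G \<subseteq> pverts G \<times> pverts G" using wellformed' by auto
  then have "inj_on (map_prod f f) (parcs G)"
    using map_prod_inj_on[OF f(1) f(1)] by (rule inj_on_subset[rotated])
  then have "pre_digraph.digraph_isomorphism (with_proj G) ?h"
    using f(1) wf_digraph by (simp add: pre_digraph.digraph_isomorphism_def)
  moreover have "with_proj H = app_iso ?h (with_proj G)"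
    by (simp add: app_iso_def with_proj_def f)
  ultimately show ?L unfolding digraph_iso_def by blast
qed

text \<open>This describes the extremal graph over any vertex type: \<open>x\<close> is the centre,
  \<open>y\<close> the fixed pendent vertex and \<open>Z\<close> the set of its additional
  neighbours.\<close>

definition H_shape :: "'a set \<Rightarrow> ('a \<times> 'a) set \<Rightarrow> 'a \<Rightarrow> 'a \<Rightarrow> 'a set \<Rightarrow> bool" where
  "H_shape V A x y Z \<longleftrightarrow> x \<in> V \<and> y \<in> V \<and> x \<noteq> y \<and> Z \<subseteq> V - {x, y} \<and>
     A = ({x} \<times> (V - {x}) \<union> (V - {x}) \<times> {x}) \<union> ({y} \<times> Z \<union> Z \<times> {y})"

lemma H_shape_image:
  assumes "inj_on f V" "H_shape V A x y Z"
  shows "H_shape (f ` V) (map_prod f f ` A) (f x) (f y) (f ` Z)"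
proof -
  have x: "x \<in> V" "y \<in> V" "x \<noteq> y" and Z: "Z \<subseteq> V - {x, y}" using assms(2) by (auto simp: H_shape_def)
  have diff: "f ` V - {f x} = f ` (V - {x})" "f ` V - {f x, f y} = f ` (V - {x, y})"
    using inj_on_image_set_diff[OF assms(1), of V "{x}"] inj_on_image_set_diff[OF assms(1), of V "{x, y}"] x
    by auto
  have prod: "map_prod f f ` (S \<times> T) = f ` S \<times> f ` T" for S T
    by (rule map_prod_surj_on) auto
  have "f x \<noteq> f y" using assms(1) x by (auto dest: inj_onD)
  moreover have "map_prod f f ` A = ({f x} \<times> f ` (V - {x}) \<union> f ` (V - {x}) \<times> {f x})
      \<union> ({f y} \<times> f ` Z \<union> f ` Z \<times> {f y})"
    using assms(2) by (simp add: H_shape_def image_Un prod)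
  ultimately show ?thesis using x Z unfolding H_shape_def diff by auto
qed

lemma H_shape_H_graph:
  assumes "k + 2 \<le> n"
  shows "H_shape (pverts (H_graph n k)) (parcs (H_graph n k)) 0 1 {2..<k + 2}"
proof -
  have "(\<Union>i\<in>I. {(c, i), (i, c)}) = {c} \<times> I \<union> I \<times> {c}" for c :: nat and I by auto
  moreover have "{0..<n} - {0} = {1..<n}" by auto
  ultimately show ?thesis using assms by (simp add: H_shape_def H_graph_def star_graph_def subset_iff)
qed

lemma digraph_iso_H_graph_iff:
  assumes "pair_wf_digraph G" "finite (pverts G)" "card (pverts G) = n" "k + 2 \<le> n"
  shows "digraph_iso (with_proj G) (with_proj (H_graph n k)) \<longleftrightarrow>
    (\<exists>x y Z. H_shape (pverts G) (parcs G) x y Z \<and> card Z = k)" (is "?L \<longleftrightarrow> ?R")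
proof
  let ?H = "H_graph n k"
  assume ?L
  then obtain f where f: "inj_on f (pverts G)" "pverts ?H = f ` pverts G"
    "parcs ?H = map_prod f f ` parcs G"
    unfolding digraph_iso_with_proj_iff[OF assms(1)] by blast
  let ?g = "the_inv_into (pverts G) f"
  have g: "inj_on ?g (pverts ?H)" "?g ` pverts ?H = pverts G"
    using inj_on_the_inv_into[OF f(1)] the_inv_into_onto[OF f(1)] by (simp_all add: f(2))
  interpret pair_wf_digraph G by fact
  have "map_prod ?g ?g (map_prod f f e) = e" if "e \<in> parcs G" for e
    using the_inv_into_f_f[OF f(1)] wellformed' that by (cases e) simp
  then have "map_prod ?g ?g ` map_prod f f ` parcs G = parcs G"
    by (simp add: image_image)
  then have "H_shape (pverts G) (parcs G) (?g 0) (?g 1) (?g ` {2..<k + 2})"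
    using H_shape_image[OF g(1) H_shape_H_graph[OF assms(4)]] by (simp add: g(2) f(3))
  moreover have "card (?g ` {2..<k + 2}) = k"
    using assms(4) by (subst card_image) (auto intro: inj_on_subset[OF g(1)] simp: H_graph_def star_graph_def)
  ultimately show ?R by blast
next
  assume ?R
  then obtain x y Z where shape: "H_shape (pverts G) (parcs G) x y Z" and Z: "card Z = k" by blast
  then have xy: "x \<in> pverts G" "y \<in> pverts G" "x \<noteq> y" "Z \<subseteq> pverts G - {x, y}"
    by (simp_all add: H_shape_def)
  let ?W = "pverts G - {x, y} - Z"
  have finZ: "finite Z" using xy assms(2) by (auto intro: finite_subset)
  have "card (pverts G - {x, y}) = n - 2" using xy assms by (simp add: card_Diff_subset)
  then have W: "card ?W = n - 2 - k" using xy finZ Z by (simp add: card_Diff_subset)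
  obtain g where g: "bij_betw g Z {2..<k + 2}"
    using finite_same_card_bij[OF finZ, of "{2..<k + 2}"] Z by auto
  obtain h where h: "bij_betw h ?W {k + 2..<n}"
    using finite_same_card_bij[of ?W "{k + 2..<n}"] W assms(2) by auto
  \<comment> \<open>The bijection is glued from four pieces of matching size: centre, fixed vertex,
    its \<open>k\<close> extra neighbours and the remaining vertices.\<close>
  define f where "f v = (if v = x then 0 else if v = y then 1 else if v \<in> Z then g v else h v)" for v
  have fZ: "bij_betw f Z {2..<k + 2}"
    by (rule iffD1[OF bij_betw_cong g]) (use xy in \<open>auto simp: f_def\<close>)
  have fW: "bij_betw f ?W {k + 2..<n}"
    by (rule iffD1[OF bij_betw_cong h]) (auto simp: f_def)
  have fxy: "bij_betw f {x, y} {0, 1}"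
    using xy(3) by (auto simp: f_def bij_betw_def)
  have "bij_betw f ({x, y} \<union> (Z \<union> ?W)) ({0, 1} \<union> ({2..<k + 2} \<union> {k + 2..<n}))"
    by (intro bij_betw_combine fZ fW fxy) auto
  moreover have "{x, y} \<union> (Z \<union> ?W) = pverts G" using xy by auto
  moreover have "{0, 1} \<union> ({2..<k + 2} \<union> {k + 2..<n}) = {0..<n}" using assms(4) by auto
  ultimately have f: "bij_betw f (pverts G) {0..<n}" by simp
  then have inj: "inj_on f (pverts G)" and img: "f ` pverts G = pverts (H_graph n k)"
    by (simp_all add: bij_betw_def H_graph_def star_graph_def)
  have "f x = 0" "f y = 1" "f ` Z = {2..<k + 2}"
    using fZ xy(3) by (auto simp: f_def bij_betw_def)
  \<comment> \<open>A shape determines the arc set from its vertex data, and these data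
    agree.\<close>
  with H_shape_image[OF inj shape] H_shape_H_graph[OF assms(4)]
  have "parcs (H_graph n k) = map_prod f f ` parcs G"
    unfolding H_shape_def img by simp
  with inj img[symmetric] show ?L unfolding digraph_iso_with_proj_iff[OF assms(1)] by blast
qed

lemma (in pair_graph) deg_pos_if_connected:
  assumes "connected (with_proj G)" "u \<in> pverts G" "2 \<le> card (pverts G)"
  shows "1 \<le> deg G u"
proof -
  have "\<not> card (pverts G) \<le> Suc 0" using assms(3) by simp
  then have "\<exists>v\<in>pverts G. v \<noteq> u"
    using card_le_Suc0_iff_eq[OF pair_finite_verts] by metis
  then obtain v where v: "v \<in> pverts G" "v \<noteq> u" by blast
  have "u \<rightarrow>\<^sup>*\<^bsub>with_proj G\<^esub> v"
    using symmetric_connected_imp_strongly_connected[OF pair_sym_arcs assms(1)] assms(2) v(1)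
    by (auto simp: strongly_connected_def)
  then obtain w where "(u, w) \<in> parcs G"
    using v(2) by (cases rule: converse_reachable_cases) auto
  then show ?thesis using finite_nbrs[of u] by (auto simp: deg_eq_card Suc_le_eq card_gt_0_iff)
qed

context rooted_graph
begin

lemma H_shape_iff:
  "H_shape (pverts G) (parcs G) x y Z \<longleftrightarrow>
    nbrs = pverts G - {x} \<and> y \<in> nbrs \<and> Z \<subseteq> nbrs - {y} \<and> off = {y} \<times> Z \<union> Z \<times> {y}"
proof -
  have split: "parcs G = ({x} \<times> nbrs \<union> nbrs \<times> {x}) \<union> off"
    using arcs_symmetric by (auto simp: nbrs_def off_def)
  show ?thesis
  proof
    assume shape: "H_shape (pverts G) (parcs G) x y Z"
    then have yZ: "y \<in> pverts G" "x \<noteq> y" "Z \<subseteq> pverts G - {x, y}"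
      and A: "parcs G = ({x} \<times> (pverts G - {x}) \<union> (pverts G - {x}) \<times> {x}) \<union> ({y} \<times> Z \<union> Z \<times> {y})"
      by (simp_all add: H_shape_def)
    have "nbrs = pverts G - {x}" unfolding nbrs_def A using yZ by auto
    moreover have "off = {y} \<times> Z \<union> Z \<times> {y}" unfolding off_def A using yZ by auto
    ultimately show "nbrs = pverts G - {x} \<and> y \<in> nbrs \<and> Z \<subseteq> nbrs - {y} \<and> off = {y} \<times> Z \<union> Z \<times> {y}"
      using yZ by auto
  next
    assume R: "nbrs = pverts G - {x} \<and> y \<in> nbrs \<and> Z \<subseteq> nbrs - {y} \<and> off = {y} \<times> Z \<union> Z \<times> {y}"
    then have "parcs G = ({x} \<times> (pverts G - {x}) \<union> (pverts G - {x}) \<times> {x}) \<union> ({y} \<times> Z \<union> Z \<times> {y})"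
      using split by simp
    moreover have "y \<in> pverts G" "x \<noteq> y" "Z \<subseteq> pverts G - {x, y}" using R by auto
    ultimately show "H_shape (pverts G) (parcs G) x y Z" using root by (simp add: H_shape_def)
  qed
qed

lemma sigma_index_dominating:
  assumes dom: "nbrs = pverts G - {x}"
    and arcs: "card (parcs G) + 2 = 2 * (card (pverts G) + k)" and n: "2 \<le> card (pverts G)"
    and bound: "bound = (int (card (pverts G)) - 1) * (int (card (pverts G)) - 2)\<^sup>2
      - 2 * int k * (2 * int (card (pverts G)) - 5) + (int k)\<^sup>2 * (int k - 1)"
  shows "sigma_index G \<le> bound"
    and "sigma_index G = bound \<longleftrightarrow> (\<exists>y Z. H_shape (pverts G) (parcs G) x y Z \<and> card Z = k)"
proof -
  have far: "far = {}" using dom by (auto simp: far_def)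
  then have off: "card off = 2 * k" using card_off_eq[OF arcs] by simp
  have card: "int (card (pverts G)) = excess x + 2" using card_pverts far by simp
  \<comment> \<open>With \<open>n = excess x + 2\<close>, the term
    \<open>- 2 * k * (2 * n - 5)\<close> leaves \<open>2 * k\<close>, which joins
    \<open>k\<^sup>2 * (k - 1)\<close>.\<close>
  have bound: "bound = (excess x + 1) * (excess x)\<^sup>2 - 4 * excess x * int k + int k * ((int k)\<^sup>2 - int k + 2)"
    unfolding bound card by (simp add: algebra_simps power2_eq_square)
  have "nbrs \<noteq> {}" using card_nbrs card n by auto
  then show "sigma_index G = bound \<longleftrightarrow> (\<exists>y Z. H_shape (pverts G) (parcs G) x y Z \<and> card Z = k)"
    unfolding bound H_shape_iff sigma_index_dominating_eq_iff[OF dom off \<open>nbrs \<noteq> {}\<close>] using dom by blast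
  show "sigma_index G \<le> bound"
    unfolding bound by (rule sigma_index_dominating_le(1)[OF dom off])
qed

end

theorem theorem2p4:
  fixes G :: "'a pair_pre_digraph" and n k :: nat
  assumes "n \<ge> 4"
    and "k \<le> n - 2"
    and "connected_cyclic k G"
    and "card (pverts G) = n"
  shows "sigma_index G \<le> (int n - 1) * (int n - 2)\<^sup>2 - 2 * int k * (2 * int n - 5) + (int k)\<^sup>2 * (int k - 1) \<and>
    (sigma_index G = (int n - 1) * (int n - 2)\<^sup>2 - 2 * int k * (2 * int n - 5) + (int k)\<^sup>2 * (int k - 1)
       \<longleftrightarrow> digraph_iso (with_proj G) (with_proj (H_graph n k)))"
proof -
  define bound where "bound = (int n - 1) * (int n - 2)\<^sup>2 - 2 * int k * (2 * int n - 5) + (int k)\<^sup>2 * (int k - 1)"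
  have graph: "pair_graph G" and conn: "connected (with_proj G)"
    and edges: "card (edge_set G) = n + k - 1"
    using assms(3,4) by (auto simp: connected_cyclic_def)
  interpret pair_graph G by fact
  have kn: "k + 2 \<le> n" using assms(1,2) by linarith
  have arcs: "card (parcs G) + 2 = 2 * (card (pverts G) + k)"
    using card_arcs_eq_twice_edges edges assms(1,4) by simp
  have two: "2 \<le> card (pverts G)" using assms(1,4) by simp
  have deg_pos: "1 \<le> deg G u" if "u \<in> pverts G" for u
    using deg_pos_if_connected[OF conn that two] .
  have iso: "digraph_iso (with_proj G) (with_proj (H_graph n k))
      \<longleftrightarrow> (\<exists>x y Z. H_shape (pverts G) (parcs G) x y Z \<and> card Z = k)"
    using pair_wf_digraph pair_finite_verts assms(4) kn by (rule digraph_iso_H_graph_iff)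
  \<comment> \<open>The centre of a given shape need not be the maximum degree vertex chosen below,
    so the graph is rooted at that centre here.\<close>
  have shape_imp: "sigma_index G = bound" if shape: "H_shape (pverts G) (parcs G) x y Z" "card Z = k" for x y Z
  proof -
    interpret rooted_graph G x
      using shape(1) by unfold_locales (simp add: H_shape_def)
    have "nbrs = pverts G - {x}" using shape(1) H_shape_iff by blast
    from sigma_index_dominating(2)[OF this arcs two refl] shape show ?thesis
      unfolding bound_def assms(4) by blast
  qed
  have "finite (deg G ` pverts G)" "deg G ` pverts G \<noteq> {}"
    using pair_finite_verts two by auto
  from Max_in[OF this] obtain x where x: "x \<in> pverts G" and xmax: "deg G x = Max (deg G ` pverts G)"
    by (metis imageE)
  have max: "deg G u \<le> deg G x" if "u \<in> pverts G" for u
    using that pair_finite_verts unfolding xmax by (intro Max_ge) auto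
  interpret rooted_graph G x by unfold_locales fact
  have "sigma_index G \<le> bound
    \<and> (sigma_index G = bound \<longrightarrow> (\<exists>x y Z. H_shape (pverts G) (parcs G) x y Z \<and> card Z = k))"
  proof (cases "far = {}")
    case True
    then have "nbrs = pverts G - {x}" using nbrs_subset by (auto simp: far_def)
    from sigma_index_dominating[OF this arcs two refl] show ?thesis
      unfolding bound_def assms(4) by blast
  next
    case False
    have "sigma_index G < bound"
      using sigma_index_nondominating_less[OF arcs _ deg_pos max False] kn
      unfolding bound_def assms(4) by blast
    then show ?thesis by simp
  qed
  then show ?thesis unfolding bound_def[symmetric] iso using shape_imp by blast
qed

end
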